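(* Let $\mathcal{S}^{+}$ be the set of primitive self-dual Fishburn matrices whose corner cell equals $1$, and define \[ \mathbf{S}^{+}(t,v,w,z)=\sum_{M\in\mathcal{S}^{+}} t^{\mathrm{mag}(M)} v^{\max(M)} w^{\mathrm{se}(M)} z^{\mathrm{dg}(M)}. \] With $V_n(a,b)=(a+1)(b+1)^n-1$, we have \[ \mathbf{S}^{+}(t,v,w,z)=\sum_{n\ge 0} t^{2n+1}\frac{1+tV_n(v,w)}{1+t^2V_n(v,w)}(1+z)^n(1+v)^n(1+w)^{\binom{n}{2}}\prod_{i=0}^{n-1}\frac{V_i(v,w)}{1+t^2V_i(v,w)}. \]
   Context: A Fishburn matrix is an upper-triangular square matrix of nonnegative integers in which every row and every column contains a nonzero entry; it is primitive if all entries are $0$ or $1$. Rows and columns of a $k\times k$ matrix are numbered $1,\dots,k$ top to bottom and left to right; $\mathrm{mag}(M)=k$. The corner cell is $(1,k)$. $M$ is self-dual if $M_{ij}=M_{k+1-j,k+1-i}$ for all $i,j$ (invariance under transposition along the anti-diagonal). A cell $(i,j)$ is a diagonal cell if $i+j=k+1$, and an SE-cell if $i+j>k+1$. Statistics: $\max(M)$ = sum of the last column excluding the corner cell; $\mathrm{se}(M)$ = sum of all SE-cells not in the last column; $\mathrm{dg}(M)$ = sum of all diagonal cells excluding the corner cell. The identity is one of formal power series. *)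

theory Defs
  imports
    "HOL-Analysis.Infinite_Sum"
    "HOL-Computational_Algebra.Formal_Power_Series"
    "Jordan_Normal_Form.Matrix"
begin

section \<open>Fishburn matrices\<close>

text \<open>Rows and columns are numbered from 1 below, whereas \<open>$$\<close> counts from 0.\<close>

definition cell :: "nat mat \<Rightarrow> nat \<Rightarrow> nat \<Rightarrow> nat" where
  "cell M i j = M $$ (i - 1, j - 1)"

definition mag :: "nat mat \<Rightarrow> nat" where
  "mag M = dim_row M"

definition fishburn :: "nat mat \<Rightarrow> bool" where
  "fishburn M \<longleftrightarrow> square_mat M \<and> upper_triangular M \<and>
     (\<forall>i\<in>{1..mag M}. \<exists>j\<in>{1..mag M}. cell M i j \<noteq> 0) \<and>
     (\<forall>j\<in>{1..mag M}. \<exists>i\<in>{1..mag M}. cell M i j \<noteq> 0)"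

definition primitive :: "nat mat \<Rightarrow> bool" where
  "primitive M \<longleftrightarrow> (\<forall>i\<in>{1..mag M}. \<forall>j\<in>{1..mag M}. cell M i j \<in> {0, 1})"

definition self_dual :: "nat mat \<Rightarrow> bool" where
  "self_dual M \<longleftrightarrow>
     (\<forall>i\<in>{1..mag M}. \<forall>j\<in>{1..mag M}. cell M i j = cell M (mag M + 1 - j) (mag M + 1 - i))"

definition cells :: "nat mat \<Rightarrow> (nat \<times> nat) set" where
  "cells M = {1..mag M} \<times> {1..mag M}"

definition corner :: "nat mat \<Rightarrow> nat \<times> nat" where
  "corner M = (1, mag M)"

definition diag_cells :: "nat mat \<Rightarrow> (nat \<times> nat) set" where
  "diag_cells M = {(i, j) \<in> cells M. i + j = mag M + 1}"

definition SE_cells :: "nat mat \<Rightarrow> (nat \<times> nat) set" where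
  "SE_cells M = {(i, j) \<in> cells M. i + j > mag M + 1}"

definition last_column :: "nat mat \<Rightarrow> (nat \<times> nat) set" where
  "last_column M = {(i, j) \<in> cells M. j = mag M}"

definition max_stat :: "nat mat \<Rightarrow> nat" where
  "max_stat M = (\<Sum>(i, j) \<in> last_column M - {corner M}. cell M i j)"

definition se_stat :: "nat mat \<Rightarrow> nat" where
  "se_stat M = (\<Sum>(i, j) \<in> SE_cells M - last_column M. cell M i j)"

definition dg_stat :: "nat mat \<Rightarrow> nat" where
  "dg_stat M = (\<Sum>(i, j) \<in> diag_cells M - {corner M}. cell M i j)"

text \<open>The condition \<open>mag M \<ge> 1\<close> says that the corner cell exists; the \<open>0 \<times> 0\<close> matrix has none.\<close>

definition S_plus :: "nat mat set" where
  "S_plus = {M. fishburn M \<and> primitive M \<and> self_dual M \<and>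
               mag M \<ge> 1 \<and> cell M (fst (corner M)) (snd (corner M)) = 1}"


section \<open>The generating function\<close>

text \<open>
  The ring of formal power series in \<open>t, v, w, z\<close> over the rationals, as an iterated power series
  ring with \<open>t\<close> as the outermost variable. The topology that the library puts on it is the
  \<open>t\<close>-adic one.
\<close>

type_synonym series = "rat fps fps fps fps"

definition t_var :: series where "t_var = fps_X"
definition v_var :: series where "v_var = fps_const fps_X"
definition w_var :: series where "w_var = fps_const (fps_const fps_X)"
definition z_var :: series where "z_var = fps_const (fps_const (fps_const fps_X))"

definition S_plus_gf :: series where
  "S_plus_gf = (\<Sum>\<^sub>\<infinity>M\<in>S_plus.
     t_var ^ mag M * v_var ^ max_stat M * w_var ^ se_stat M * z_var ^ dg_stat M)"

definition V :: "nat \<Rightarrow> 'a::comm_ring_1 \<Rightarrow> 'a \<Rightarrow> 'a" where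
  "V n a b = (a + 1) * (b + 1) ^ n - 1"


section \<open>Well-definedness\<close>

text \<open>
  The sum defining \<open>S_plus_gf\<close> converges, each coefficient of a power of \<open>t\<close> being a finite sum,
  and the denominators \<open>1 + t\<^sup>2 V\<^sub>n(v, w)\<close> are units, so that the division is the genuine one.
\<close>

lemma finite_S_plus_mag: "finite {M \<in> S_plus. mag M = k}"
proof -
  let ?F = "({..<k} \<times> {..<k}) \<rightarrow>\<^sub>E {0, 1::nat}"
  have "M \<in> (\<lambda>f. mat k k f) ` ?F" if "M \<in> S_plus" "mag M = k" for M
  proof (rule image_eqI)
    have dim: "dim_row M = k" "dim_col M = k"
      using that by (auto simp: S_plus_def fishburn_def mag_def)
    show "M = mat k k (restrict (\<lambda>ij. M $$ ij) ({..<k} \<times> {..<k}))"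
      by (rule eq_matI) (auto simp: dim)
    have "M $$ (i, j) \<in> {0, 1}" if "i < k" "j < k" for i j
    proof -
      have "cell M (Suc i) (Suc j) \<in> {0, 1}"
        using \<open>M \<in> S_plus\<close> that dim unfolding S_plus_def primitive_def mag_def by auto
      thus ?thesis by (simp add: cell_def)
    qed
    thus "restrict (\<lambda>ij. M $$ ij) ({..<k} \<times> {..<k}) \<in> ?F"
      by (intro restrict_PiE_iff[THEN iffD2] ballI) (metis SigmaE lessThan_iff)
  qed
  hence "{M \<in> S_plus. mag M = k} \<subseteq> (\<lambda>f. mat k k f) ` ?F" by blast
  moreover have "finite ((\<lambda>f. mat k k f) ` ?F)"
    by (intro finite_imageI finite_PiE) auto
  ultimately show ?thesis by (rule finite_subset)
qed

lemma has_sum_fpsI: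
  fixes c :: "'i \<Rightarrow> 'a::comm_ring_1" and d :: "'i \<Rightarrow> nat"
  assumes fin: "\<And>k. finite {x \<in> A. d x = k}"
  shows "((\<lambda>x. fps_X ^ d x * fps_const (c x)) has_sum
           Abs_fps (\<lambda>k. \<Sum>x | x \<in> A \<and> d x = k. c x)) A"
  unfolding has_sum_def
proof (rule tendstoI)
  fix e :: real assume "e > 0"
  let ?S = "Abs_fps (\<lambda>k. \<Sum>x | x \<in> A \<and> d x = k. c x)"
  let ?f = "\<lambda>x. fps_X ^ d x * fps_const (c x)"
  obtain n :: nat where n: "inverse (2 ^ n) < e"
    using reals_power_lt_ex[of e 2] \<open>e > 0\<close> by (auto simp: field_simps)
  let ?X = "{x \<in> A. d x < n}"
  have "?X = (\<Union>k<n. {x \<in> A. d x = k})" by auto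
  hence finX: "finite ?X" using fin by simp
  show "\<forall>\<^sub>F Y in finite_subsets_at_top A. dist (sum ?f Y) ?S < e"
    unfolding eventually_finite_subsets_at_top
  proof (intro exI[of _ ?X] conjI allI impI finX)
    fix Y assume Y: "finite Y \<and> ?X \<subseteq> Y \<and> Y \<subseteq> A"
    have eq: "fps_nth (sum ?f Y) k = fps_nth ?S k" if "k < n" for k
    proof -
      have "fps_nth (sum ?f Y) k = (\<Sum>x\<in>Y. if d x = k then c x else 0)"
        unfolding fps_sum_nth
        by (rule sum.cong) (auto simp: fps_X_power_mult_nth)
      also have "\<dots> = (\<Sum>x\<in>{x \<in> Y. d x = k}. c x)"
        using Y by (simp add: sum.inter_filter)
      also have "{x \<in> Y. d x = k} = {x. x \<in> A \<and> d x = k}" using Y that by auto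
      finally show ?thesis by simp
    qed
    show "dist (sum ?f Y) ?S < e"
    proof (cases "sum ?f Y = ?S")
      case False
      hence "subdegree (sum ?f Y - ?S) \<ge> n"
        by (intro subdegree_geI) (use eq in auto)
      hence "inverse (2 ^ subdegree (sum ?f Y - ?S)) \<le> inverse (2 ^ n :: real)"
        by (intro le_imp_inverse_le power_increasing) auto
      with n have "inverse (2 ^ subdegree (sum ?f Y - ?S)) < e" by linarith
      with False show ?thesis by (simp only: dist_fps_def if_False)
    qed (use \<open>e > 0\<close> in simp)
  qed auto
qed

lemma S_plus_gf_has_sum:
  "((\<lambda>M. t_var ^ mag M * v_var ^ max_stat M * w_var ^ se_stat M * z_var ^ dg_stat M)
      has_sum S_plus_gf) S_plus"
  and S_plus_gf_nth: "fps_nth S_plus_gf k = (\<Sum>M | M \<in> S_plus \<and> mag M = k.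
    fps_X ^ max_stat M * fps_const fps_X ^ se_stat M * fps_const (fps_const fps_X) ^ dg_stat M)"
proof -
  let ?c = "\<lambda>M. fps_X ^ max_stat M * fps_const fps_X ^ se_stat M *
              fps_const (fps_const fps_X) ^ dg_stat M :: rat fps fps fps"
  have "t_var ^ mag M * v_var ^ max_stat M * w_var ^ se_stat M * z_var ^ dg_stat M
          = fps_X ^ mag M * fps_const (?c M)" for M
    by (simp add: t_var_def v_var_def w_var_def z_var_def fps_const_power mult.assoc
             flip: fps_const_mult)
  hence *: "((\<lambda>M. t_var ^ mag M * v_var ^ max_stat M * w_var ^ se_stat M * z_var ^ dg_stat M)
      has_sum Abs_fps (\<lambda>k. \<Sum>M | M \<in> S_plus \<and> mag M = k. ?c M)) S_plus"
    using has_sum_fpsI[OF finite_S_plus_mag, of ?c] by simp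
  hence **: "S_plus_gf = Abs_fps (\<lambda>k. \<Sum>M | M \<in> S_plus \<and> mag M = k. ?c M)"
    unfolding S_plus_gf_def by (rule infsumI)
  show "((\<lambda>M. t_var ^ mag M * v_var ^ max_stat M * w_var ^ se_stat M * z_var ^ dg_stat M)
      has_sum S_plus_gf) S_plus" using * ** by simp
  show "fps_nth S_plus_gf k = (\<Sum>M | M \<in> S_plus \<and> mag M = k. ?c M)" by (simp add: **)
qed

lemma series_divide_cancel:
  fixes f g :: series
  assumes "fps_nth g 0 = 1"
  shows "f / g * g = f"
proof -
  have inv1: "inverse (1 :: rat fps fps fps) = 1"
    by (intro fps_inverse_one' fps_inverse_one)
  have "subdegree g = 0" using assms by (intro subdegree_eq_0) simp
  hence "f / g = f * inverse g" by (simp add: fps_divide_def)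
  moreover have "g * inverse g = 1"
    by (subst fps_inverse_def, rule fps_right_inverse) (simp add: assms inv1)
  ultimately show ?thesis by (simp add: mult.assoc mult.commute[of _ g])
qed

lemma denominator_nth_0: "fps_nth (1 + t_var\<^sup>2 * V n v_var w_var) 0 = 1"
  by (simp add: t_var_def)

end

theory Submission
  imports Defs
begin

text \<open>
  Reading the columns of a \<open>k \<times> k\<close> matrix from right to left turns self-duality into symmetry and
  upper triangularity into the vanishing of all cells \<open>(i, q)\<close> with \<open>i + q \<ge> k\<close> (counting from 0).
  A matrix in \<open>\<S>\<^sup>+\<close> is thus a symmetric 0-1 matrix supported on this triangle, with entry 1 at
  \<open>(0, 0)\<close> and without zero rows, and the cells \<open>(i, q) \<noteq> (0, 0)\<close> with \<open>q \<le> i\<close> can be chosen freely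
  apart from the condition on the rows.

  The lower half of the rows, \<open>2 i \<ge> k\<close>, consist of disjoint sets of free cells, so that the condition
  for row \<open>i\<close> yields a factor \<open>V\<^sub>c(v, w)\<close>. For the rows \<open>0 < i < k/2\<close> inclusion-exclusion is
  used. If \<open>A\<close> is the set of those that are not forced to vanish, then the lower row \<open>k - 1 - j\<close>
  contributes \<open>V\<^sub>c\<close> with \<open>c = |A \<inter> {1..j}|\<close>, and the upper rows contribute
  \<open>(1+z)\<^sup>n (1+v)\<^sup>n (1+w)\<^bsup>n choose 2\<^esup>\<close> with \<open>n = |A|\<close>. For fixed \<open>n\<close>, the signed sum over \<open>A\<close>
  satisfies a two-term recurrence in \<open>k\<close>, since the last row may or may not belong to \<open>A\<close>. Its
  generating function is \<open>t\<^bsup>2n\<^esup> \<Prod>\<^bsub>i<n\<^esub> V\<^sub>i / \<Prod>\<^bsub>i\<le>n\<^esub> (1 + t\<^sup>2 V\<^sub>i)\<close>. Odd and even \<open>k\<close> account for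
  the two summands of the factor \<open>1 + t V\<^sub>n\<close>.
\<close>

section \<open>Inclusion-exclusion and product expansions\<close>

text \<open>The indicator of "no \<open>i\<close> is bad" is the product of the factors
  \<open>1 - of_bool (bad i x)\<close>; expand it over the subsets of \<open>I\<close> and exchange
  the sums.\<close>

lemma sum_inclusion_exclusion:
  fixes f :: "'x \<Rightarrow> 'a::comm_ring_1"
  assumes "finite U" "finite I"
  shows "(\<Sum>x | x \<in> U \<and> (\<forall>i\<in>I. \<not> bad i x). f x) =
           (\<Sum>B\<in>Pow I. (-1) ^ card B * (\<Sum>x | x \<in> U \<and> (\<forall>i\<in>B. bad i x). f x))"
proof -
  have of_bool_Ball: "of_bool (\<forall>i\<in>B. P i) = (\<Prod>i\<in>B. of_bool (P i) :: 'a)" if "finite B" for B P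
    using that by (induction B) (auto simp: of_bool_conj)
  have ie: "of_bool (\<forall>i\<in>I. \<not> bad i x) =
          (\<Sum>B\<in>Pow I. (-1) ^ card B * of_bool (\<forall>i\<in>B. bad i x) :: 'a)" for x
  proof -
    have "of_bool (\<forall>i\<in>I. \<not> bad i x) = (\<Prod>i\<in>I. - of_bool (bad i x) + 1 :: 'a)"
      unfolding of_bool_Ball[OF \<open>finite I\<close>] by (intro prod.cong) auto
    also have "\<dots> = (\<Sum>B\<in>Pow I. (\<Prod>i\<in>B. - of_bool (bad i x)))"
      by (simp add: prod_add[OF \<open>finite I\<close>] del: add_uminus_conv_diff uminus_add_conv_diff)
    also have "\<dots> = (\<Sum>B\<in>Pow I. (-1) ^ card B * of_bool (\<forall>i\<in>B. bad i x))"
      using finite_subset[OF _ \<open>finite I\<close>] by (intro sum.cong) (auto simp: prod_uminus of_bool_Ball)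
    finally show ?thesis .
  qed
  have restrict: "(\<Sum>x | x \<in> U \<and> P x. f x) = (\<Sum>x\<in>U. of_bool (P x) * f x)" for P
    unfolding sum.inter_filter[OF \<open>finite U\<close>] by (intro sum.cong) auto
  show ?thesis
    unfolding restrict ie
    by (simp add: sum_distrib_left sum_distrib_right sum.swap[of _ U] mult.assoc)
qed

lemma sum_Pow_prod:
  fixes f :: "'x \<Rightarrow> 'a::comm_semiring_1"
  assumes "finite D"
  shows "(\<Sum>Y\<in>Pow D. \<Prod>q\<in>Y. f q) = (\<Prod>q\<in>D. f q + 1)"
  using assms by (simp add: prod_add)

text \<open>The exponents of \<open>y\<close> are the ranks 0, ..., \<open>card A - 1\<close> of the
  elements of \<open>A\<close>. A new maximum leaves the ranks of the others unchanged, hence the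
  induction.\<close>

lemma prod_power_card_below:
  fixes x y :: "'a::comm_semiring_1"
  assumes "finite (A :: 'b::linorder set)"
  shows "(\<Prod>i\<in>A. x * y ^ card {j\<in>A. j < i}) = x ^ card A * y ^ (card A choose 2)"
  using assms
proof (induction A rule: finite_linorder_max_induct)
  case (insert b A)
  have "{j \<in> insert b A. j < b} = A" using insert.hyps by auto
  moreover have "{j \<in> insert b A. j < i} = {j \<in> A. j < i}" if "i \<in> A" for i
    using insert.hyps that by auto
  moreover have "b \<notin> A" using insert.hyps by auto
  ultimately show ?case
    using insert by (simp add: numeral_2_eq_2 power_add mult_ac)
qed (simp add: numeral_2_eq_2)

section \<open>Row families\<close>

text \<open>
  All coordinates are the 0-based pairs \<open>(i, q)\<close>, where \<open>q = 0\<close> is the last column; then \<open>q < i\<close>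
  describes the SE-cells and \<open>q = i\<close> the diagonal cells. A row family assigns to every \<open>i > 0\<close> the
  set of all \<open>q \<le> i\<close> for which cell \<open>(i, q)\<close> is nonzero; the cells with \<open>q > i\<close> are given by symmetry.
\<close>

definition cell_weight :: "'a \<Rightarrow> 'a \<Rightarrow> 'a \<Rightarrow> nat \<Rightarrow> nat \<Rightarrow> 'a::comm_ring_1" where
  "cell_weight v w z i q = (if q = i then z else if q = 0 then v else w)"

definition row_cells :: "nat \<Rightarrow> nat \<Rightarrow> nat set" where
  "row_cells k i = {q. q \<le> i \<and> i + q < k}"

definition row_families :: "nat \<Rightarrow> (nat \<Rightarrow> nat set) set" where
  "row_families k = {X \<in> (\<Pi>\<^sub>E i\<in>{1..<k}. Pow (row_cells k i)).
     \<forall>i\<in>{1..<k}. X i \<noteq> {} \<or> (\<exists>j\<in>{1..<k}. i \<in> X j)}"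

definition family_weight :: "'a \<Rightarrow> 'a \<Rightarrow> 'a \<Rightarrow> nat \<Rightarrow> (nat \<Rightarrow> nat set) \<Rightarrow> 'a::comm_ring_1" where
  "family_weight v w z k X = (\<Prod>i\<in>{1..<k}. \<Prod>q\<in>X i. cell_weight v w z i q)"

text \<open>
  The possible rows \<open>i\<close> of a family in which the rows of \<open>B\<close> vanish (as symmetric rows) and all
  rows \<open>i\<close> with \<open>2 * i \<ge> k\<close> are nonzero. For the latter the symmetric part contributes nothing,
  so that no inclusion-exclusion is needed for them.
\<close>

definition admissible_rows :: "nat \<Rightarrow> nat set \<Rightarrow> nat \<Rightarrow> nat set set" where
  "admissible_rows k B i =
     (if 2 * i < k then if i \<in> B then {{}} else Pow (row_cells k i - B)
      else Pow (row_cells k i - B) - {{}})"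

lemma finite_row_cells [simp]: "finite (row_cells k i)"
  by (rule finite_subset[of _ "{..i}"]) (auto simp: row_cells_def)

text \<open>Inclusion-exclusion over the upper rows, where \<open>i\<close> is bad if its symmetric
  row vanishes. Once the set \<open>B\<close> of vanishing rows is fixed, the remaining conditions
  concern each \<open>X i\<close> separately, so the sum factors over the rows.\<close>

lemma sum_row_families:
  fixes v w z :: "'a::comm_ring_1"
  shows "(\<Sum>X\<in>row_families k. family_weight v w z k X) =
     (\<Sum>B\<in>Pow {i. 1 \<le> i \<and> 2 * i < k}. (-1) ^ card B *
        (\<Prod>i\<in>{1..<k}. \<Sum>Y\<in>admissible_rows k B i. \<Prod>q\<in>Y. cell_weight v w z i q))"
proof -
  let ?I = "{i. 1 \<le> i \<and> 2 * i < k}"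
  let ?bad = "\<lambda>i X. X i = {} \<and> (\<forall>j\<in>{1..<k}. i \<notin> X j)"
  define U where "U = {X \<in> \<Pi>\<^sub>E i\<in>{1..<k}. Pow (row_cells k i).
    \<forall>i\<in>{1..<k}. k \<le> 2 * i \<longrightarrow> X i \<noteq> {}}"
  have fin_U: "finite U"
    unfolding U_def by (rule finite_subset[OF _ finite_PiE[of "{1..<k}" "\<lambda>i. Pow (row_cells k i)"]]) auto
  have fin_I: "finite ?I" by (rule finite_subset[of _ "{..k}"]) auto
  \<comment> \<open>Membership would give \<open>i \<le> j\<close> and \<open>i + j < k\<close>,
    hence \<open>2 * i < k\<close>.\<close>
  have low: "i \<notin> X j" if "X \<in> (\<Pi>\<^sub>E i\<in>{1..<k}. Pow (row_cells k i))" "k \<le> 2 * i" "j \<in> {1..<k}"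
    for X i j
    using PiE_mem[OF that(1,3)] that(2) by (auto simp: row_cells_def)
  have split: "row_families k = {X. X \<in> U \<and> (\<forall>i\<in>?I. \<not> ?bad i X)}"
  proof (intro Set.set_eqI iffI)
    fix X assume X: "X \<in> row_families k"
    show "X \<in> {X. X \<in> U \<and> (\<forall>i\<in>?I. \<not> ?bad i X)}"
      using X low[of X] unfolding row_families_def U_def by fastforce
  next
    fix X assume X: "X \<in> {X. X \<in> U \<and> (\<forall>i\<in>?I. \<not> ?bad i X)}"
    have "X i \<noteq> {} \<or> (\<exists>j\<in>{1..<k}. i \<in> X j)" if "i \<in> {1..<k}" for i
      using X that by (cases "2 * i < k") (auto simp: U_def)
    thus "X \<in> row_families k" using X unfolding row_families_def U_def by simp
  qed
  have bad_eq: "{X. X \<in> U \<and> (\<forall>i\<in>B. ?bad i X)} = (\<Pi>\<^sub>E i\<in>{1..<k}. admissible_rows k B i)"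
    if "B \<subseteq> ?I" for B
  proof (intro Set.set_eqI iffI)
    fix X assume X: "X \<in> {X. X \<in> U \<and> (\<forall>i\<in>B. ?bad i X)}"
    show "X \<in> (\<Pi>\<^sub>E i\<in>{1..<k}. admissible_rows k B i)"
    proof (rule PiE_I)
      fix i assume i: "i \<in> {1..<k}"
      have "X i \<subseteq> row_cells k i" using X i unfolding U_def by auto
      thus "X i \<in> admissible_rows k B i"
        using X i unfolding U_def admissible_rows_def by auto
    qed (use X in \<open>auto simp: U_def PiE_def extensional_def\<close>)
  next
    fix X assume X: "X \<in> (\<Pi>\<^sub>E i\<in>{1..<k}. admissible_rows k B i)"
    have row: "X i \<in> admissible_rows k B i" if "i \<in> {1..<k}" for i
      using PiE_mem[OF X that] .
    have "X i \<subseteq> row_cells k i" "X i \<inter> B = {}" "k \<le> 2 * i \<longrightarrow> X i \<noteq> {}" "i \<in> B \<longrightarrow> X i = {}"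
      if "i \<in> {1..<k}" for i
      using row[OF that] \<open>B \<subseteq> ?I\<close> by (auto simp: admissible_rows_def split: if_splits)
    moreover have "B \<subseteq> {1..<k}" using \<open>B \<subseteq> ?I\<close> by auto
    moreover have "X \<in> extensional {1..<k}" using X by (simp add: PiE_def)
    ultimately show "X \<in> {X. X \<in> U \<and> (\<forall>i\<in>B. ?bad i X)}"
      unfolding U_def PiE_def Pi_def by blast
  qed
  have "(\<Sum>X\<in>row_families k. family_weight v w z k X) =
     (\<Sum>B\<in>Pow ?I. (-1) ^ card B * (\<Sum>X | X \<in> U \<and> (\<forall>i\<in>B. ?bad i X). family_weight v w z k X))"
    unfolding split by (rule sum_inclusion_exclusion[OF fin_U fin_I])
  also have "\<dots> = (\<Sum>B\<in>Pow ?I. (-1) ^ card B *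
        (\<Prod>i\<in>{1..<k}. \<Sum>Y\<in>admissible_rows k B i. \<Prod>q\<in>Y. cell_weight v w z i q))"
  proof (rule sum.cong[OF refl])
    fix B assume "B \<in> Pow ?I"
    hence eq: "{X. X \<in> U \<and> (\<forall>i\<in>B. ?bad i X)} = (\<Pi>\<^sub>E i\<in>{1..<k}. admissible_rows k B i)"
      by (intro bad_eq PowD)
    have "(\<Sum>X | X \<in> U \<and> (\<forall>i\<in>B. ?bad i X). family_weight v w z k X) =
        (\<Prod>i\<in>{1..<k}. \<Sum>Y\<in>admissible_rows k B i. \<Prod>q\<in>Y. cell_weight v w z i q)"
      unfolding eq family_weight_def
      by (rule prod_sum_PiE[symmetric]) (auto simp: admissible_rows_def)
    thus "(-1) ^ card B * (\<Sum>X | X \<in> U \<and> (\<forall>i\<in>B. ?bad i X). family_weight v w z k X) =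
        (-1) ^ card B *
          (\<Prod>i\<in>{1..<k}. \<Sum>Y\<in>admissible_rows k B i. \<Prod>q\<in>Y. cell_weight v w z i q)"
      by (rule arg_cong)
  qed
  finally show ?thesis .
qed

section \<open>Weight sums of single rows\<close>

text \<open>\<open>p \<le> i\<close> keeps the diagonal cell out, and column 0 is present because
  \<open>1 \<le> p\<close> and \<open>0 \<notin> B\<close>: one factor \<open>v + 1\<close>, all
  others \<open>w + 1\<close>.\<close>

lemma prod_cell_weight:
  fixes v w z :: "'a::comm_ring_1"
  assumes "0 \<notin> B" "p \<le> i" "1 \<le> p"
  shows "(\<Prod>q\<in>{..<p} - B. cell_weight v w z i q + 1) = (v + 1) * (w + 1) ^ card ({1..<p} - B)"
proof -
  have "{..<p} - B = insert 0 ({1..<p} - B)" using assms by auto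
  hence "(\<Prod>q\<in>{..<p} - B. cell_weight v w z i q + 1) =
      (cell_weight v w z i 0 + 1) * (\<Prod>q\<in>{1..<p} - B. cell_weight v w z i q + 1)"
    by simp
  also have "(\<Prod>q\<in>{1..<p} - B. cell_weight v w z i q + 1) = (\<Prod>q\<in>{1..<p} - B. w + 1)"
    using assms by (intro prod.cong) (auto simp: cell_weight_def)
  finally show ?thesis using assms by (simp add: cell_weight_def)
qed

text \<open>An upper row reaches its diagonal cell, whence \<open>z + 1\<close>. A lower row stops
  at column \<open>k - i - 1 < i\<close>, and excluding the empty row subtracts 1, which produces
  \<open>V\<close>.\<close>

lemma sum_admissible_rows:
  fixes v w z :: "'a::comm_ring_1"
  assumes "0 \<notin> B" "i \<in> {1..<k}"
  shows "(\<Sum>Y\<in>admissible_rows k B i. \<Prod>q\<in>Y. cell_weight v w z i q) =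
     (if 2 * i < k then if i \<in> B then 1 else (z + 1) * (v + 1) * (w + 1) ^ card ({1..<i} - B)
      else V (card ({1..<k - i} - B)) v w)"
proof (cases "2 * i < k")
  case True
  have rc: "row_cells k i = insert i {..<i}" using True by (auto simp: row_cells_def)
  show ?thesis
  proof (cases "i \<in> B")
    case False
    hence "row_cells k i - B = insert i ({..<i} - B)" by (auto simp: rc)
    hence "(\<Sum>Y\<in>admissible_rows k B i. \<Prod>q\<in>Y. cell_weight v w z i q) =
        (z + 1) * (\<Prod>q\<in>{..<i} - B. cell_weight v w z i q + 1)"
      using True False by (simp add: admissible_rows_def sum_Pow_prod cell_weight_def)
    thus ?thesis using True False assms by (simp add: prod_cell_weight mult.assoc)
  qed (use True in \<open>simp add: admissible_rows_def\<close>)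
next
  case False
  have rc: "row_cells k i = {..<k - i}" using False by (auto simp: row_cells_def)
  have "(\<Sum>Y\<in>admissible_rows k B i. \<Prod>q\<in>Y. cell_weight v w z i q) =
      (\<Sum>Y\<in>Pow (row_cells k i - B). \<Prod>q\<in>Y. cell_weight v w z i q) - 1"
    using False by (simp add: admissible_rows_def sum_diff)
  also have "\<dots> = (v + 1) * (w + 1) ^ card ({1..<k - i} - B) - 1"
    using False assms by (subst sum_Pow_prod) (auto simp: rc prod_cell_weight)
  finally show ?thesis using False by (simp add: V_def)
qed

section \<open>Signed sums over sets of upper rows\<close>

text \<open>\<open>A\<close> consists of the upper rows not forced to vanish, the sign counts the
  others, and the product collects the lower rows of a matrix of size \<open>2 * s + 1\<close>, with
  \<open>j\<close> counting from the bottom.\<close>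

definition signed_subset_sum :: "'a \<Rightarrow> 'a \<Rightarrow> nat \<Rightarrow> nat \<Rightarrow> 'a::comm_ring_1" where
  "signed_subset_sum v w s n = (\<Sum>A | A \<subseteq> {1..s} \<and> card A = n.
     (-1) ^ (s - n) * (\<Prod>j<s. V (card (A \<inter> {1..j})) v w))"

definition free_cells_weight :: "'a \<Rightarrow> 'a \<Rightarrow> 'a \<Rightarrow> nat \<Rightarrow> 'a::comm_ring_1" where
  "free_cells_weight v w z n = (1 + z) ^ n * (1 + v) ^ n * (1 + w) ^ (n choose 2)"

text \<open>There are \<open>s\<close> upper rows besides row 0 and \<open>m\<close> lower rows;
  \<open>m = s\<close> and \<open>m = Suc s\<close> are the two parities of the size. The sum over
  \<open>B\<close> is rewritten over the complement \<open>A = {1..s} - B\<close>.\<close>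

lemma sum_row_families_subsets:
  fixes v w z :: "'a::comm_ring_1"
  assumes "m = s \<or> m = Suc s"
  shows "(\<Sum>X\<in>row_families (Suc (s + m)). family_weight v w z (Suc (s + m)) X) =
     (\<Sum>A\<in>Pow {1..s}. (-1) ^ (s - card A) * free_cells_weight v w z (card A) *
        (\<Prod>j<m. V (card (A \<inter> {1..j})) v w))"
proof -
  let ?k = "Suc (s + m)"
  have I: "{i. 1 \<le> i \<and> 2 * i < ?k} = {1..s}" using assms by auto
  have "(\<Prod>i\<in>{1..<?k}. \<Sum>Y\<in>admissible_rows ?k ({1..s} - A) i. \<Prod>q\<in>Y. cell_weight v w z i q) =
      free_cells_weight v w z (card A) * (\<Prod>j<m. V (card (A \<inter> {1..j})) v w)"
    if A: "A \<subseteq> {1..s}" for A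
  proof -
    let ?B = "{1..s} - A"
    let ?r = "\<lambda>i. \<Sum>Y\<in>admissible_rows ?k ?B i. \<Prod>q\<in>Y. cell_weight v w z i q"
    have finA: "finite A" using A finite_subset by blast
    have "(\<Prod>i\<in>{1..<?k}. ?r i) = (\<Prod>i\<in>{1..s}. ?r i) * (\<Prod>i\<in>{Suc s..<?k}. ?r i)"
      by (subst prod.union_disjoint[symmetric]) (auto simp del: prod.op_ivl_Suc intro!: prod.cong)
    \<comment> \<open>Rows in \<open>B\<close> contribute the factor 1.\<close>
    also have "(\<Prod>i\<in>{1..s}. ?r i) = (\<Prod>i\<in>A. ?r i)"
      using A assms by (intro prod.mono_neutral_right) (auto simp: sum_admissible_rows)
    also have "\<dots> = (\<Prod>i\<in>A. ((z + 1) * (v + 1)) * (w + 1) ^ card {j\<in>A. j < i})"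
    proof (intro prod.cong refl)
      fix i assume i: "i \<in> A"
      have "{1..<i} - ?B = {j\<in>A. j < i}" using A i by fastforce
      thus "?r i = ((z + 1) * (v + 1)) * (w + 1) ^ card {j\<in>A. j < i}"
        using A i assms by (subst sum_admissible_rows) auto
    qed
    also have "\<dots> = free_cells_weight v w z (card A)"
      using finA by (simp add: prod_power_card_below free_cells_weight_def power_mult_distrib add.commute)
    \<comment> \<open>Substitute \<open>j = s + m - i\<close>. As \<open>j < m \<le> Suc s\<close>,
      the columns \<open>{1..j}\<close> lie within \<open>{1..s}\<close>, where avoiding
      \<open>B\<close> means belonging to \<open>A\<close>.\<close>
    also have "(\<Prod>i\<in>{Suc s..<?k}. ?r i) = (\<Prod>j<m. V (card (A \<inter> {1..j})) v w)"
    proof (rule prod.reindex_bij_witness[of _ "\<lambda>j. s + m - j" "\<lambda>i. s + m - i"])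
      fix i assume i: "i \<in> {Suc s..<?k}"
      have "{1..<?k - i} - ?B = A \<inter> {1..s + m - i}" using A assms i by auto
      thus "V (card (A \<inter> {1..s + m - i})) v w = ?r i"
        using i assms by (subst sum_admissible_rows) auto
    qed auto
    finally show ?thesis .
  qed
  hence "(\<Sum>A\<in>Pow {1..s}. (-1) ^ (s - card A) * free_cells_weight v w z (card A) *
        (\<Prod>j<m. V (card (A \<inter> {1..j})) v w)) =
     (\<Sum>A\<in>Pow {1..s}. (-1) ^ card ({1..s} - A) *
        (\<Prod>i\<in>{1..<?k}. \<Sum>Y\<in>admissible_rows ?k ({1..s} - A) i. \<Prod>q\<in>Y. cell_weight v w z i q))"
    by (intro sum.cong refl) (auto simp: card_Diff_subset finite_subset mult.assoc)
  also have "\<dots> = (\<Sum>B\<in>Pow {1..s}. (-1) ^ card B *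
        (\<Prod>i\<in>{1..<?k}. \<Sum>Y\<in>admissible_rows ?k B i. \<Prod>q\<in>Y. cell_weight v w z i q))"
    by (rule sum.reindex_bij_witness[of _ "\<lambda>B. {1..s} - B" "\<lambda>A. {1..s} - A"]) auto
  finally show ?thesis unfolding sum_row_families I by simp
qed

lemma sum_Pow_by_card:
  assumes "finite S"
  shows "(\<Sum>A\<in>Pow S. f A) = (\<Sum>n\<le>card S. \<Sum>A | A \<subseteq> S \<and> card A = n. f A)"
proof -
  have "(\<Sum>A\<in>Pow S. f A) = (\<Sum>n\<le>card S. \<Sum>A | A \<in> Pow S \<and> card A = n. f A)"
    using assms by (intro sum.group[symmetric]) (auto intro: card_mono)
  thus ?thesis by simp
qed

lemma sum_row_families_odd:
  fixes v w z :: "'a::comm_ring_1"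
  shows "(\<Sum>X\<in>row_families (2 * s + 1). family_weight v w z (2 * s + 1) X) =
     (\<Sum>n\<le>s. free_cells_weight v w z n * signed_subset_sum v w s n)"
  using sum_row_families_subsets[of s s v w z]
  by (simp add: sum_Pow_by_card signed_subset_sum_def sum_distrib_left mult_ac flip: mult_2)

text \<open>Compared with the odd case there is one more lower row, \<open>j = s\<close>. It sees
  all of \<open>A\<close>, so its factor \<open>V n v w\<close> depends on \<open>n\<close>
  only.\<close>

lemma sum_row_families_even:
  fixes v w z :: "'a::comm_ring_1"
  shows "(\<Sum>X\<in>row_families (2 * s + 2). family_weight v w z (2 * s + 2) X) =
     (\<Sum>n\<le>s. free_cells_weight v w z n * V n v w * signed_subset_sum v w s n)"
proof -
  have "(\<Sum>X\<in>row_families (2 * s + 2). family_weight v w z (2 * s + 2) X) =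
     (\<Sum>n\<le>s. \<Sum>A | A \<subseteq> {1..s} \<and> card A = n.
        (-1) ^ (s - card A) * free_cells_weight v w z (card A) *
        (\<Prod>j<Suc s. V (card (A \<inter> {1..j})) v w))"
    using sum_row_families_subsets[of "Suc s" s v w z] by (simp add: sum_Pow_by_card flip: mult_2)
  also have "\<dots> = (\<Sum>n\<le>s. free_cells_weight v w z n * V n v w * signed_subset_sum v w s n)"
    unfolding signed_subset_sum_def sum_distrib_left
  proof (intro sum.cong refl)
    fix n A assume A: "A \<in> {A. A \<subseteq> {1..s} \<and> card A = n}"
    hence "A \<inter> {1..s} = A" by auto
    thus "(-1) ^ (s - card A) * free_cells_weight v w z (card A) *
          (\<Prod>j<Suc s. V (card (A \<inter> {1..j})) v w) =
        free_cells_weight v w z n * V n v w *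
          ((-1) ^ (s - n) * (\<Prod>j<s. V (card (A \<inter> {1..j})) v w))"
      using A by (simp add: mult_ac)
  qed
  finally show ?thesis .
qed

lemma signed_subset_sum_eq_0: "s < n \<Longrightarrow> signed_subset_sum v w s n = 0"
  unfolding signed_subset_sum_def
proof (rule sum.neutral)
  assume "s < n"
  have False if "A \<subseteq> {1..s}" "card A = n" for A
    using card_mono[OF _ that(1)] that(2) \<open>s < n\<close> by simp
  thus "\<forall>A\<in>{A. A \<subseteq> {1..s} \<and> card A = n}.
      (-1) ^ (s - n) * (\<Prod>j<s. V (card (A \<inter> {1..j})) v w) = 0" by blast
qed

lemma signed_subset_sum_0 [simp]: "signed_subset_sum v w 0 n = of_bool (n = 0)"
proof -
  have "{A. A \<subseteq> {1..0::nat} \<and> card A = n} = (if n = 0 then {{}} else {})" by auto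
  thus ?thesis by (simp add: signed_subset_sum_def)
qed

text \<open>Split by whether \<open>Suc s \<in> A\<close>. This element exceeds every cutoff
  \<open>j \<le> s\<close>, so it affects no factor; the new factor \<open>j = s\<close> is
  \<open>V\<close> at \<open>n - 1\<close> or \<open>n\<close>, and omitting \<open>Suc s\<close>
  flips the sign.\<close>

lemma signed_subset_sum_Suc:
  fixes v w :: "'a::comm_ring_1"
  shows "signed_subset_sum v w (Suc s) n =
    (if n = 0 then 0 else V (n - 1) v w * signed_subset_sum v w s (n - 1))
      - V n v w * signed_subset_sum v w s n"
proof -
  let ?S = "\<lambda>s n. {A. A \<subseteq> {1..s::nat} \<and> card A = n}"
  let ?f = "\<lambda>s n A. (-1) ^ (s - n) * (\<Prod>j<s. V (card (A \<inter> {1..j})) v w) :: 'a"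
  have fin: "finite (?S s n)" for s n by (rule finite_subset[of _ "Pow {1..s}"]) auto
  have cut: "insert (Suc s) A \<inter> {1..j} = A \<inter> {1..j}" if "j \<le> s" for A j
    using that by auto
  have split: "?S (Suc s) n = ?S s n \<union> (if n = 0 then {} else insert (Suc s) ` ?S s (n - 1))"
  proof (intro Set.set_eqI iffI)
    fix A assume A: "A \<in> ?S (Suc s) n"
    hence "finite A" using finite_subset[of A "{1..Suc s}"] by simp
    show "A \<in> ?S s n \<union> (if n = 0 then {} else insert (Suc s) ` ?S s (n - 1))"
    proof (cases "Suc s \<in> A")
      case True
      hence "A = insert (Suc s) (A - {Suc s})" "n \<noteq> 0" "A - {Suc s} \<in> ?S s (n - 1)"
        using A \<open>finite A\<close> by (auto simp: atLeastAtMostSuc_conv card_gt_0_iff)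
      hence "A \<in> insert (Suc s) ` ?S s (n - 1)" by (intro image_eqI)
      thus ?thesis using \<open>n \<noteq> 0\<close> by simp
    next
      case False
      thus ?thesis using A by (auto simp: atLeastAtMostSuc_conv)
    qed
  next
    fix A assume "A \<in> ?S s n \<union> (if n = 0 then {} else insert (Suc s) ` ?S s (n - 1))"
    then consider "A \<in> ?S s n" | C where "A = insert (Suc s) C" "C \<in> ?S s (n - 1)" "n \<noteq> 0"
      by (auto split: if_splits)
    thus "A \<in> ?S (Suc s) n"
    proof cases
      case 2
      moreover have "finite C" "Suc s \<notin> C" using 2 finite_subset[of C "{1..s}"] by auto
      ultimately show ?thesis by auto
    qed auto
  qed
  have "signed_subset_sum v w (Suc s) n = (\<Sum>A\<in>?S s n. ?f (Suc s) n A) +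
      (\<Sum>A\<in>(if n = 0 then {} else insert (Suc s) ` ?S s (n - 1)). ?f (Suc s) n A)"
    unfolding signed_subset_sum_def split by (rule sum.union_disjoint) (auto simp: fin)
  also have "(\<Sum>A\<in>?S s n. ?f (Suc s) n A) = - V n v w * signed_subset_sum v w s n"
    unfolding signed_subset_sum_def sum_distrib_left
  proof (intro sum.cong refl)
    fix A assume A: "A \<in> ?S s n"
    \<comment> \<open>Without truncation, \<open>Suc s - n = Suc (s - n)\<close> yields the extra
      sign.\<close>
    hence "n \<le> s" using card_mono[of "{1..s}" A] by auto
    moreover have "A \<inter> {1..s} = A" using A by auto
    ultimately show "?f (Suc s) n A = - V n v w * ?f s n A"
      using A by (simp add: Suc_diff_le)
  qed
  also have "(\<Sum>A\<in>(if n = 0 then {} else insert (Suc s) ` ?S s (n - 1)). ?f (Suc s) n A) =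
      (if n = 0 then 0 else V (n - 1) v w * signed_subset_sum v w s (n - 1))"
  proof (cases "n = 0")
    case False
    have "inj_on (insert (Suc s)) (?S s (n - 1))"
    proof (rule inj_onI)
      fix A B assume "A \<in> ?S s (n - 1)" "B \<in> ?S s (n - 1)" "insert (Suc s) A = insert (Suc s) B"
      moreover have "Suc s \<notin> A" "Suc s \<notin> B" using calculation by auto
      ultimately show "A = B" by (metis insert_ident)
    qed
    hence "(\<Sum>A\<in>insert (Suc s) ` ?S s (n - 1). ?f (Suc s) n A) =
        (\<Sum>A\<in>?S s (n - 1). ?f (Suc s) n (insert (Suc s) A))"
      by (simp add: sum.reindex)
    also have "\<dots> = V (n - 1) v w * signed_subset_sum v w s (n - 1)"
      unfolding signed_subset_sum_def sum_distrib_left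
    proof (intro sum.cong refl)
      fix A assume A: "A \<in> ?S s (n - 1)"
      hence "A \<inter> {1..s} = A" by auto
      thus "?f (Suc s) n (insert (Suc s) A) = V (n - 1) v w * ?f s (n - 1) A"
        using A False by (cases n) (simp_all add: cut mult_ac)
    qed
    finally show ?thesis using False by simp
  qed simp
  finally show ?thesis by simp
qed


section \<open>Self-dual matrices as row families\<close>

definition reflected :: "nat mat \<Rightarrow> nat \<Rightarrow> nat \<Rightarrow> nat" where
  "reflected M i q = M $$ (i, dim_row M - 1 - q)"

lemma reflected_cell:
  assumes "i \<in> {1..mag M}" "j \<in> {1..mag M}"
  shows "cell M i j = reflected M (i - 1) (mag M - j)"
proof -
  have "mag M - 1 - (mag M - j) = j - 1" using assms by auto
  thus ?thesis by (simp add: cell_def reflected_def mag_def)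
qed

text \<open>\<open>P\<close> may depend on the position as well as the entry, so that both
  primitivity and self-duality are instances.\<close>

lemma ball_cells_reflected:
  "(\<forall>i\<in>{1..mag M}. \<forall>j\<in>{1..mag M}. P i j (cell M i j)) \<longleftrightarrow>
     (\<forall>i<mag M. \<forall>q<mag M. P (Suc i) (mag M - q) (reflected M i q))" (is "?L \<longleftrightarrow> ?R")
proof
  assume ?L
  show ?R
  proof (intro allI impI)
    fix i q assume *: "i < mag M" "q < mag M"
    hence "P (Suc i) (mag M - q) (cell M (Suc i) (mag M - q))" using \<open>?L\<close> by auto
    thus "P (Suc i) (mag M - q) (reflected M i q)" using * by (subst (asm) reflected_cell) auto
  qed
next
  assume ?R
  show ?L
  proof (intro ballI)
    fix i j assume *: "i \<in> {1..mag M}" "j \<in> {1..mag M}"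
    hence "i - 1 < mag M" "mag M - j < mag M" by auto
    hence "P (Suc (i - 1)) (mag M - (mag M - j)) (reflected M (i - 1) (mag M - j))"
      using \<open>?R\<close> by blast
    thus "P i j (cell M i j)" using * by (subst reflected_cell) auto
  qed
qed

text \<open>Reflected column \<open>q\<close> is the 0-based column \<open>k - 1 - q\<close>, which
  lies left of the main diagonal in row \<open>i\<close> iff \<open>k \<le> i + q\<close>.
  Anti-diagonal transposition swaps \<open>i\<close> and \<open>q\<close>.\<close>

lemma S_plus_iff_reflected:
  "M \<in> S_plus \<and> mag M = k \<longleftrightarrow>
     M \<in> carrier_mat k k \<and> 1 \<le> k \<and> reflected M 0 0 = 1 \<and>
     (\<forall>i<k. \<forall>q<k. reflected M i q \<in> {0, 1} \<and> reflected M i q = reflected M q i \<and>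
        (k \<le> i + q \<longrightarrow> reflected M i q = 0)) \<and>
     (\<forall>i<k. \<exists>q<k. reflected M i q \<noteq> 0)"
  (is "?L \<longleftrightarrow> ?R")
proof (cases "M \<in> carrier_mat k k \<and> 1 \<le> k")
  case True
  hence k: "mag M = k" "dim_row M = k" "dim_col M = k" "1 \<le> k" by (auto simp: mag_def)
  have prim: "primitive M \<longleftrightarrow> (\<forall>i<k. \<forall>q<k. reflected M i q \<in> {0, 1})"
    unfolding primitive_def ball_cells_reflected[where P = "\<lambda>i j x. x \<in> {0, 1}"]
    by (simp only: k)
  have corner: "cell M (fst (corner M)) (snd (corner M)) = reflected M 0 0"
    using k by (simp add: corner_def cell_def reflected_def)
  have dual_cell: "cell M (k + 1 - (k - q)) (k + 1 - Suc i) = reflected M q i"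
    if "i < k" "q < k" for i q
    using that k by (subst reflected_cell) auto
  have dual: "self_dual M \<longleftrightarrow> (\<forall>i<k. \<forall>q<k. reflected M i q = reflected M q i)"
    unfolding self_dual_def
      ball_cells_reflected[where P = "\<lambda>i j x. x = cell M (mag M + 1 - j) (mag M + 1 - i)"]
    using dual_cell by (auto simp only: k)
  have tri: "upper_triangular M \<longleftrightarrow> (\<forall>i<k. \<forall>q<k. k \<le> i + q \<longrightarrow> reflected M i q = 0)"
  proof
    assume ut: "upper_triangular M"
    show "\<forall>i<k. \<forall>q<k. k \<le> i + q \<longrightarrow> reflected M i q = 0"
    proof (intro allI impI)
      fix i q assume "i < k" "q < k" "k \<le> i + q"
      thus "reflected M i q = 0"
        unfolding reflected_def using k by (intro upper_triangularD[OF ut]) auto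
    qed
  next
    assume R: "\<forall>i<k. \<forall>q<k. k \<le> i + q \<longrightarrow> reflected M i q = 0"
    show "upper_triangular M"
    proof (rule upper_triangularI)
      fix i j assume "j < i" "i < dim_row M"
      moreover from this have "reflected M i (k - 1 - j) = 0" using R k by auto
      ultimately show "M $$ (i, j) = 0" using k by (simp add: reflected_def)
    qed
  qed
  have rows: "(\<forall>i\<in>{1..mag M}. \<exists>j\<in>{1..mag M}. cell M i j \<noteq> 0) \<longleftrightarrow>
      (\<forall>i<k. \<exists>q<k. reflected M i q \<noteq> 0)" (is "?A \<longleftrightarrow> ?B")
  proof
    assume A: ?A
    show ?B
    proof (intro allI impI)
      fix i assume "i < k"
      hence i: "Suc i \<in> {1..mag M}" using k by simp
      then obtain j where j: "j \<in> {1..mag M}" "cell M (Suc i) j \<noteq> 0" using A by blast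
      have "reflected M i (k - j) \<noteq> 0" using reflected_cell[OF i j(1)] j(2) k(1) by simp
      moreover have "k - j < k" using j(1) k by auto
      ultimately show "\<exists>q<k. reflected M i q \<noteq> 0" by blast
    qed
  next
    assume B: ?B
    show ?A
    proof
      fix i assume i: "i \<in> {1..mag M}"
      hence "i - 1 < k" using k by auto
      then obtain q where q: "q < k" "reflected M (i - 1) q \<noteq> 0" using B by blast
      hence kq: "k - q \<in> {1..mag M}" using k by auto
      have "cell M i (k - q) \<noteq> 0" using reflected_cell[OF i kq] q k(1) by simp
      thus "\<exists>j\<in>{1..mag M}. cell M i j \<noteq> 0" using kq by blast
    qed
  qed
  \<comment> \<open>Self-duality carries row \<open>mag M + 1 - j\<close> to column
    \<open>j\<close>.\<close>
  have cols: "\<forall>j\<in>{1..mag M}. \<exists>i\<in>{1..mag M}. cell M i j \<noteq> 0"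
    if sd: "self_dual M" and A: "\<forall>i\<in>{1..mag M}. \<exists>j\<in>{1..mag M}. cell M i j \<noteq> 0"
  proof
    fix j assume j: "j \<in> {1..mag M}"
    hence j': "mag M + 1 - j \<in> {1..mag M}" by auto
    then obtain l where l: "l \<in> {1..mag M}" "cell M (mag M + 1 - j) l \<noteq> 0" using A by blast
    hence l': "mag M + 1 - l \<in> {1..mag M}" by auto
    have "mag M + 1 - (mag M + 1 - j) = j" using j by auto
    hence "cell M (mag M + 1 - l) j \<noteq> 0"
      using sd[unfolded self_dual_def, rule_format, OF j' l(1)] l(2) by simp
    thus "\<exists>i\<in>{1..mag M}. cell M i j \<noteq> 0" using l' by blast
  qed
  have "square_mat M" "1 \<le> mag M" using k by auto
  hence "M \<in> S_plus \<longleftrightarrow> upper_triangular M \<and>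
      (\<forall>i\<in>{1..mag M}. \<exists>j\<in>{1..mag M}. cell M i j \<noteq> 0) \<and> primitive M \<and> self_dual M \<and>
      reflected M 0 0 = 1"
    unfolding S_plus_def fishburn_def mem_Collect_eq corner using cols by blast
  hence S: "M \<in> S_plus \<longleftrightarrow> (\<forall>i<k. \<forall>q<k. k \<le> i + q \<longrightarrow> reflected M i q = 0) \<and>
      (\<forall>i<k. \<exists>q<k. reflected M i q \<noteq> 0) \<and> (\<forall>i<k. \<forall>q<k. reflected M i q \<in> {0, 1}) \<and>
      (\<forall>i<k. \<forall>q<k. reflected M i q = reflected M q i) \<and> reflected M 0 0 = 1"
    unfolding prim dual tri rows .
  have conj: "(\<forall>i<k. \<forall>q<k. A i q \<and> B i q \<and> C i q) \<longleftrightarrow>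
      (\<forall>i<k. \<forall>q<k. A i q) \<and> (\<forall>i<k. \<forall>q<k. B i q) \<and> (\<forall>i<k. \<forall>q<k. C i q)" for A B C
    by blast
  show ?thesis unfolding S conj k(1) using True by argo
next
  case False
  moreover have "M \<in> carrier_mat k k \<and> 1 \<le> k" if "M \<in> S_plus" "mag M = k"
    using that by (auto simp: S_plus_def fishburn_def mag_def)
  ultimately show ?thesis by blast
qed

lemma
  assumes "M \<in> S_plus"
  shows S_plus_carrier: "M \<in> carrier_mat (mag M) (mag M)"
    and reflected_corner: "reflected M 0 0 = 1"
  using S_plus_iff_reflected[THEN iffD1, OF conjI[OF assms refl]] by blast+

lemma
  assumes "M \<in> S_plus" "i < mag M" "q < mag M"
  shows reflected_primitive: "reflected M i q = 0 \<or> reflected M i q = 1"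
    and reflected_sym: "reflected M i q = reflected M q i"
    and reflected_triangular: "reflected M i q \<noteq> 0 \<Longrightarrow> i + q < mag M"
    and reflected_row: "\<exists>p<mag M. reflected M i p \<noteq> 0"
proof -
  note M = S_plus_iff_reflected[THEN iffD1, OF conjI[OF assms(1) refl]]
  have entry: "reflected M i q \<in> {0, 1} \<and> reflected M i q = reflected M q i \<and>
      (mag M \<le> i + q \<longrightarrow> reflected M i q = 0)"
    using M[THEN conjunct2, THEN conjunct2, THEN conjunct2, THEN conjunct1] assms(2,3) by blast
  show "reflected M i q = 0 \<or> reflected M i q = 1" using entry by blast
  show "reflected M i q = reflected M q i" using entry by blast
  show "i + q < mag M" if "reflected M i q \<noteq> 0" using entry that by linarith
  show "\<exists>p<mag M. reflected M i p \<noteq> 0"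
    using M[THEN conjunct2, THEN conjunct2, THEN conjunct2, THEN conjunct2] assms(2) by blast
qed

section \<open>Bijection between matrices and row families\<close>

definition row_family :: "nat mat \<Rightarrow> nat \<Rightarrow> nat set" where
  "row_family M = restrict (\<lambda>i. {q. q \<le> i \<and> reflected M i q \<noteq> 0}) {1..<mag M}"

text \<open>\<open>max\<close> and \<open>min\<close> fold each cell into the half
  \<open>q \<le> i\<close>; \<open>max i q = 0\<close> is the corner, fixed to 1.\<close>

definition family_entry :: "(nat \<Rightarrow> nat set) \<Rightarrow> nat \<Rightarrow> nat \<Rightarrow> nat" where
  "family_entry X i q = (if max i q = 0 \<or> min i q \<in> X (max i q) then 1 else 0)"

definition family_mat :: "nat \<Rightarrow> (nat \<Rightarrow> nat set) \<Rightarrow> nat mat" where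
  "family_mat k X = mat k k (\<lambda>(i, j). family_entry X i (k - 1 - j))"

lemma family_mat_carrier [simp]: "family_mat k X \<in> carrier_mat k k"
  by (simp add: family_mat_def)

lemma mag_family_mat [simp]: "mag (family_mat k X) = k"
  by (simp add: family_mat_def mag_def)

lemma reflected_family_mat:
  assumes "i < k" "q < k"
  shows "reflected (family_mat k X) i q = family_entry X i q"
proof -
  have "k - 1 - (k - 1 - q) = q" using assms by simp
  thus ?thesis using assms by (simp add: reflected_def family_mat_def)
qed

text \<open>A nonzero entry \<open>(i, q)\<close> is recorded in row \<open>i\<close> if
  \<open>q \<le> i\<close>, and otherwise, by symmetry, in row \<open>q\<close>.\<close>

lemma row_family_in_row_families:
  assumes "M \<in> S_plus"
  shows "row_family M \<in> row_families (mag M)"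
proof -
  have "row_family M i \<in> Pow (row_cells (mag M) i)" if "i \<in> {1..<mag M}" for i
    using that by (auto simp: row_family_def row_cells_def intro!: reflected_triangular[OF assms])
  moreover have "row_family M i \<noteq> {} \<or> (\<exists>j\<in>{1..<mag M}. i \<in> row_family M j)"
    if i: "i \<in> {1..<mag M}" for i
  proof -
    obtain q where q: "q < mag M" "reflected M i q \<noteq> 0" using reflected_row[OF assms, of i] i by auto
    show ?thesis
    proof (cases "q \<le> i")
      case True
      hence "q \<in> row_family M i" using q i by (simp add: row_family_def)
      thus ?thesis by blast
    next
      case False
      moreover have "reflected M q i \<noteq> 0" using reflected_sym[OF assms, of i q] q i by auto
      ultimately have "i \<in> row_family M q" "q \<in> {1..<mag M}"
        using q i by (auto simp: row_family_def)
      thus ?thesis by blast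
    qed
  qed
  moreover have "row_family M \<in> extensional {1..<mag M}" by (simp add: row_family_def)
  ultimately show ?thesis unfolding row_families_def PiE_def Pi_def by blast
qed

lemma family_mat_row_family:
  assumes "M \<in> S_plus"
  shows "family_mat (mag M) (row_family M) = M"
proof (rule eq_matI)
  fix i j assume *: "i < dim_row M" "j < dim_col M"
  let ?k = "mag M" and ?q = "mag M - 1 - j"
  have dims: "dim_row M = ?k" "dim_col M = ?k" using S_plus_carrier[OF assms] by auto
  have lt: "i < ?k" "?q < ?k" "j < ?k" using * dims by auto
  have at: "N $$ (i, j) = reflected N i ?q" if "dim_row N = ?k" for N
    using lt that by (simp add: reflected_def)
  have sym: "reflected M i ?q = reflected M (max i ?q) (min i ?q)"
    using reflected_sym[OF assms lt(1,2)] by (auto simp: max_def min_def)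
  have "reflected (family_mat ?k (row_family M)) i ?q = reflected M (max i ?q) (min i ?q)"
  proof (cases "max i ?q = 0")
    case True
    thus ?thesis using reflected_corner[OF assms] lt by (simp add: reflected_family_mat family_entry_def)
  next
    case False
    have "reflected M (max i ?q) (min i ?q) = 0 \<or> reflected M (max i ?q) (min i ?q) = 1"
      by (rule reflected_primitive[OF assms]) (use lt in auto)
    moreover have "max i ?q \<in> {1..<?k}" using False lt by auto
    ultimately show ?thesis using False
      by (subst reflected_family_mat[OF lt(1,2)]) (auto simp: row_family_def family_entry_def)
  qed
  thus "family_mat ?k (row_family M) $$ (i, j) = M $$ (i, j)"
    using at[of M] at[of "family_mat ?k (row_family M)"] sym dims
    by (simp only: mag_def[symmetric] mag_family_mat)
next
  show "dim_row (family_mat (mag M) (row_family M)) = dim_row M"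
    by (simp add: family_mat_def mag_def)
  show "dim_col (family_mat (mag M) (row_family M)) = dim_col M"
    using carrier_matD[OF S_plus_carrier[OF assms]] by (simp add: family_mat_def)
qed

lemma family_mat_in_S_plus:
  assumes "X \<in> row_families k" "1 \<le> k"
  shows "family_mat k X \<in> S_plus" "mag (family_mat k X) = k"
proof -
  have X: "X i \<subseteq> row_cells k i" if "i \<in> {1..<k}" for i
    using assms that by (auto simp: row_families_def)
  have tri: "\<not> (max i q = 0 \<or> min i q \<in> X (max i q))" if "i < k" "q < k" "k \<le> i + q" for i q
  proof
    assume "max i q = 0 \<or> min i q \<in> X (max i q)"
    \<comment> \<open>\<open>max i q = 0\<close> would contradict
      \<open>k \<le> i + q\<close>.\<close>
    moreover have "max i q \<in> {1..<k}" using that by (auto simp: max_def)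
    ultimately have "min i q \<in> row_cells k (max i q)" using X by fastforce
    thus False using that by (auto simp: row_cells_def max_def min_def split: if_splits)
  qed
  have rows: "\<exists>q<k. max i q = 0 \<or> min i q \<in> X (max i q)" if "i < k" for i
  proof (cases "i = 0")
    case False
    hence i: "i \<in> {1..<k}" using that by simp
    then consider q where "q \<in> X i" | j where "j \<in> {1..<k}" "i \<in> X j"
      using assms unfolding row_families_def by blast
    thus ?thesis
    proof cases
      case 1
      hence "q \<le> i" using X[OF i] by (auto simp: row_cells_def)
      with 1 that show ?thesis by (intro exI[of _ q]) (auto simp: max_def min_def)
    next
      case 2
      hence "i \<le> j" using X[of j] by (auto simp: row_cells_def)
      with 2 show ?thesis by (intro exI[of _ j]) (auto simp: max_def min_def)
    qed
  qed (use \<open>1 \<le> k\<close> in \<open>auto intro!: exI[of _ 0]\<close>)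
  have "family_mat k X \<in> S_plus \<and> mag (family_mat k X) = k"
    unfolding S_plus_iff_reflected
  proof (intro conjI allI impI)
    show "reflected (family_mat k X) 0 0 = 1"
      using assms(2) by (simp add: reflected_family_mat family_entry_def)
  next
    fix i q assume iq: "i < k" "q < k"
    show "reflected (family_mat k X) i q \<in> {0, 1}"
      using iq by (simp add: reflected_family_mat family_entry_def)
    show "reflected (family_mat k X) i q = reflected (family_mat k X) q i"
      using iq by (simp add: reflected_family_mat family_entry_def max.commute min.commute)
    assume "k \<le> i + q"
    thus "reflected (family_mat k X) i q = 0"
      using iq tri unfolding reflected_family_mat[OF iq] family_entry_def by (simp only: if_False)
  next
    fix i assume "i < k"
    then obtain q where "q < k" "max i q = 0 \<or> min i q \<in> X (max i q)" using rows by blast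
    thus "\<exists>q<k. reflected (family_mat k X) i q \<noteq> 0"
      using \<open>i < k\<close> by (intro exI[of _ q]) (simp add: reflected_family_mat family_entry_def)
  qed (use assms(2) in auto)
  thus "family_mat k X \<in> S_plus" "mag (family_mat k X) = k" by auto
qed

lemma row_family_family_mat:
  assumes "X \<in> row_families k"
  shows "row_family (family_mat k X) = X"
proof
  fix i
  have X: "X i \<subseteq> row_cells k i" if "i \<in> {1..<k}" for i
    using assms that by (auto simp: row_families_def)
  have "X i = undefined" if "i \<notin> {1..<k}"
    using assms that by (auto simp: row_families_def PiE_def extensional_def)
  moreover have "{q. q \<le> i \<and> reflected (family_mat k X) i q \<noteq> 0} = X i" if "i \<in> {1..<k}"
    using X[OF that] that
    by (auto simp: reflected_family_mat family_entry_def row_cells_def max_def min_def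
             split: if_splits)
  ultimately show "row_family (family_mat k X) i = X i"
    unfolding row_family_def by simp
qed

section \<open>Statistics as weights of row families\<close>

text \<open>Common form of the three statistics: entries are 0 or 1, so the sum counts nonzero
  cells. The condition \<open>i + j \<ge> mag M + 1\<close> becomes \<open>q \<le> i\<close> in
  reflected coordinates, where \<open>P\<close> describes the region \<open>C\<close>.\<close>

lemma sum_cells_reflected:
  assumes M: "M \<in> S_plus" and C: "C \<subseteq> cells M - {corner M}"
    and P: "\<And>i j. (i, j) \<in> cells M - {corner M} \<Longrightarrow> i + j \<ge> mag M + 1 \<Longrightarrow>
              (i, j) \<in> C \<longleftrightarrow> P (i - 1) (mag M - j)"
    and ge: "\<And>i j. (i, j) \<in> C \<Longrightarrow> i + j \<ge> mag M + 1"
  shows "(\<Sum>(i, j)\<in>C. cell M i j) =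
           (\<Sum>(i, q)\<in>Sigma {1..<mag M} (row_family M). of_bool (P i q))"
proof -
  let ?k = "mag M" and ?Y = "Sigma {1..<mag M} (row_family M)"
  have "finite (cells M)" by (simp add: cells_def)
  hence finC: "finite C" using C finite_subset by blast
  have rowM: "q \<le> i" "reflected M i q = 1" if "i \<in> {1..<?k}" "q \<in> row_family M i" for i q
    using that reflected_primitive[OF M, of i q] by (auto simp: row_family_def)
  have "?Y \<subseteq> {..<?k} \<times> {..<?k}" using rowM(1) by fastforce
  hence finY: "finite ?Y" by (rule finite_subset) simp
  \<comment> \<open>Dropping zero terms on both sides leaves sets in bijection, with all terms equal
    to 1.\<close>
  have "(\<Sum>(i, j)\<in>C. cell M i j) = (\<Sum>(i, j)\<in>C - {(i, j)\<in>C. cell M i j = 0}. cell M i j)"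
    using finC by (intro sum.mono_neutral_right) auto
  also have "\<dots> = (\<Sum>(i, q)\<in>?Y - {(i, q)\<in>?Y. \<not> P i q}. of_bool (P i q))"
  proof (rule sum.reindex_bij_witness
      [where i = "\<lambda>(i, q). (Suc i, ?k - q)" and j = "\<lambda>(i, j). (i - 1, ?k - j)"])
    fix a assume a: "a \<in> C - {(i, j)\<in>C. cell M i j = 0}"
    obtain i j where ij: "a = (i, j)" by force
    hence in_cells: "i \<in> {1..?k}" "j \<in> {1..?k}" "(i, j) \<noteq> (1, ?k)" "(i, j) \<in> C"
      using a C by (auto simp: cells_def corner_def)
    have nz: "reflected M (i - 1) (?k - j) \<noteq> 0"
      using a ij reflected_cell[OF in_cells(1,2)] in_cells by auto
    have sum: "i + j \<ge> ?k + 1" using ge in_cells by blast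
    \<comment> \<open>\<open>i = 1\<close> would force \<open>j = mag M\<close>, the excluded
      corner.\<close>
    hence i: "i - 1 \<in> {1..<?k}" using in_cells by auto
    hence row: "?k - j \<in> row_family M (i - 1)" using nz sum by (auto simp: row_family_def)
    have p: "P (i - 1) (?k - j)" using P sum in_cells C by blast
    show "(case case a of (i, j) \<Rightarrow> (i - 1, ?k - j) of (i, q) \<Rightarrow> (Suc i, ?k - q)) = a"
      using in_cells ij by auto
    show "(case a of (i, j) \<Rightarrow> (i - 1, ?k - j)) \<in> ?Y - {(i, q)\<in>?Y. \<not> P i q}"
      using i row p ij by auto
    have "reflected M (i - 1) (?k - j) = 1" using rowM(2)[OF i row] .
    thus "(case case a of (i, j) \<Rightarrow> (i - 1, ?k - j) of (i, q) \<Rightarrow> of_bool (P i q)) =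
        (case a of (i, j) \<Rightarrow> cell M i j)"
      using ij p reflected_cell[OF in_cells(1,2)] by simp
  next
    fix b assume b: "b \<in> ?Y - {(i, q)\<in>?Y. \<not> P i q}"
    then obtain i q where iq: "b = (i, q)" "i \<in> {1..<?k}" "q \<in> row_family M i" "P i q" by auto
    have q: "q \<le> i" "q < ?k" "reflected M i q = 1" using iq(2) rowM[OF iq(2,3)] by auto
    have mem: "(Suc i, ?k - q) \<in> cells M - {corner M}"
      using iq q by (auto simp: cells_def corner_def)
    moreover have "Suc i + (?k - q) \<ge> ?k + 1" using q by auto
    ultimately have "(Suc i, ?k - q) \<in> C" using P iq q by auto
    moreover have "cell M (Suc i) (?k - q) \<noteq> 0"
      using mem q iq reflected_cell[of "Suc i" M "?k - q"] by (auto simp: cells_def)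
    ultimately show "(case b of (i, q) \<Rightarrow> (Suc i, ?k - q)) \<in> C - {(i, j)\<in>C. cell M i j = 0}"
      using iq by auto
    show "(case case b of (i, q) \<Rightarrow> (Suc i, ?k - q) of (i, j) \<Rightarrow> (i - 1, ?k - j)) = b"
      using iq q by auto
  qed
  also have "\<dots> = (\<Sum>(i, q)\<in>?Y. of_bool (P i q))"
    using finY by (intro sum.mono_neutral_left) auto
  finally show ?thesis .
qed

lemma statistics_row_family:
  assumes "M \<in> S_plus"
  defines "Y \<equiv> Sigma {1..<mag M} (row_family M)"
  shows "max_stat M = (\<Sum>(i, q)\<in>Y. of_bool (q = 0))"
    and "se_stat M = (\<Sum>(i, q)\<in>Y. of_bool (0 < q \<and> q < i))"
    and "dg_stat M = (\<Sum>(i, q)\<in>Y. of_bool (q = i))"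
proof -
  show "max_stat M = (\<Sum>(i, q)\<in>Y. of_bool (q = 0))"
    unfolding max_stat_def Y_def
    by (rule sum_cells_reflected[OF assms(1)]) (auto simp: last_column_def cells_def)
  show "se_stat M = (\<Sum>(i, q)\<in>Y. of_bool (0 < q \<and> q < i))"
    unfolding se_stat_def Y_def
    by (rule sum_cells_reflected[OF assms(1)])
      (auto simp: SE_cells_def last_column_def cells_def corner_def)
  show "dg_stat M = (\<Sum>(i, q)\<in>Y. of_bool (q = i))"
    unfolding dg_stat_def Y_def
    by (rule sum_cells_reflected[OF assms(1)]) (auto simp: diag_cells_def cells_def)
qed

text \<open>For \<open>q \<le> i\<close> and \<open>1 \<le> i\<close> exactly one of the three
  indicators is 1, so each cell contributes a single variable.\<close>

lemma statistics_weight: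
  fixes v w z :: "'a::comm_ring_1"
  assumes "M \<in> S_plus"
  shows "v ^ max_stat M * w ^ se_stat M * z ^ dg_stat M =
           family_weight v w z (mag M) (row_family M)"
proof -
  let ?Y = "Sigma {1..<mag M} (row_family M)"
  have row: "q \<le> i" if "i \<in> {1..<mag M}" "q \<in> row_family M i" for i q
    using that by (auto simp: row_family_def)
  have fin: "finite (row_family M i)" if "i \<in> {1..<mag M}" for i
    by (rule finite_subset[of _ "{..i}"]) (use row[OF that] in auto)
  have "v ^ max_stat M * w ^ se_stat M * z ^ dg_stat M =
      (\<Prod>(i, q)\<in>?Y. v ^ of_bool (q = 0) * w ^ of_bool (0 < q \<and> q < i) * z ^ of_bool (q = i))"
    unfolding statistics_row_family[OF assms] power_sum prod.distrib[symmetric]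
    by (simp add: case_prod_beta)
  also have "\<dots> = (\<Prod>(i, q)\<in>?Y. cell_weight v w z i q)"
    by (intro prod.cong) (auto simp: cell_weight_def dest!: row[rotated])
  also have "\<dots> = family_weight v w z (mag M) (row_family M)"
    unfolding family_weight_def using fin by (subst prod.Sigma) auto
  finally show ?thesis .
qed

lemma sum_S_plus_mag:
  fixes v w z :: "'a::comm_ring_1"
  assumes "1 \<le> k"
  shows "(\<Sum>M | M \<in> S_plus \<and> mag M = k. v ^ max_stat M * w ^ se_stat M * z ^ dg_stat M) =
           (\<Sum>X\<in>row_families k. family_weight v w z k X)"
proof (rule sum.reindex_bij_witness[of _ "family_mat k" row_family])
  fix M assume "M \<in> {M. M \<in> S_plus \<and> mag M = k}"
  hence M: "M \<in> S_plus" "mag M = k" by auto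
  show "family_mat k (row_family M) = M" using family_mat_row_family[OF M(1)] M(2) by simp
  show "row_family M \<in> row_families k" using row_family_in_row_families[OF M(1)] M(2) by simp
  show "family_weight v w z k (row_family M) =
      v ^ max_stat M * w ^ se_stat M * z ^ dg_stat M"
    using statistics_weight[OF M(1), of v w z] M(2) by simp
next
  fix X assume X: "X \<in> row_families k"
  show "row_family (family_mat k X) = X" by (rule row_family_family_mat[OF X])
  show "family_mat k X \<in> {M. M \<in> S_plus \<and> mag M = k}"
    using family_mat_in_S_plus[OF X assms] by simp
qed


section \<open>The generating function\<close>

text \<open>The variable of this series is \<open>t\<close>: a step of \<open>s\<close> adds two rows to the matrix.\<close>

definition layer_series :: "'a \<Rightarrow> 'a \<Rightarrow> nat \<Rightarrow> 'a::comm_ring_1 fps" where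
  "layer_series v w n = Abs_fps (\<lambda>k. if even k then signed_subset_sum v w (k div 2) n else 0)"

text \<open>Coefficientwise this is \<open>signed_subset_sum_Suc\<close>, its negative term moved to
  the left; the constant term is the initial value at \<open>s = 0\<close>.\<close>

lemma layer_series_rec:
  fixes v w :: "'a::comm_ring_1"
  shows "layer_series v w n * (1 + fps_X\<^sup>2 * fps_const (V n v w)) =
    (if n = 0 then 1 else fps_X\<^sup>2 * (fps_const (V (n - 1) v w) * layer_series v w (n - 1)))"
proof (rule fps_ext)
  fix k :: nat
  have lhs: "layer_series v w n * (1 + fps_X\<^sup>2 * fps_const (V n v w)) =
      layer_series v w n + fps_X\<^sup>2 * (fps_const (V n v w) * layer_series v w n)"
    by (simp add: algebra_simps)
  have "k = 0 \<or> k = 1 \<or> (\<exists>l. k = l + 2)" by presburger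
  then consider "k = 0" | "k = 1" | l where "k = l + 2" by blast
  thus "fps_nth (layer_series v w n * (1 + fps_X\<^sup>2 * fps_const (V n v w))) k =
     fps_nth (if n = 0 then 1
       else fps_X\<^sup>2 * (fps_const (V (n - 1) v w) * layer_series v w (n - 1))) k"
    unfolding lhs
    by cases (auto simp: layer_series_def fps_X_power_mult_nth signed_subset_sum_Suc)
qed

text \<open>Iterates the recurrence in \<open>n\<close>. The denominators stay multiplied out, so
  the identity holds over any commutative ring.\<close>

lemma layer_series_closed_form:
  fixes v w :: "'a::comm_ring_1"
  shows "layer_series v w n * (\<Prod>i\<le>n. 1 + fps_X\<^sup>2 * fps_const (V i v w)) =
    fps_X ^ (2 * n) * (\<Prod>i<n. fps_const (V i v w))"
proof (induction n)
  case 0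
  thus ?case by (simp add: layer_series_rec)
next
  case (Suc n)
  let ?D = "\<lambda>i. 1 + fps_X\<^sup>2 * fps_const (V i v w)"
  have "layer_series v w (Suc n) * (\<Prod>i\<le>Suc n. ?D i) =
      (layer_series v w (Suc n) * ?D (Suc n)) * (\<Prod>i\<le>n. ?D i)"
    by (simp only: prod.atMost_Suc mult_ac)
  also have "\<dots> = fps_X\<^sup>2 * fps_const (V n v w) * (layer_series v w n * (\<Prod>i\<le>n. ?D i))"
    by (simp only: layer_series_rec) (simp add: mult_ac)
  finally show ?case
    unfolding Suc by (simp add: mult_ac power2_eq_square)
qed

section \<open>Summands and convergence\<close>

lemma V_fps_const: "V n (fps_const a) (fps_const b) = fps_const (V n a b)"
  by (simp add: V_def fps_const_power flip: fps_const_1_eq_1)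

text \<open>\<open>a\<close>, \<open>b\<close>, \<open>c\<close> are \<open>v\<close>,
  \<open>w\<close>, \<open>z\<close> in the coefficient ring of \<open>t\<close>. Both sides are
  compared after multiplication by all denominators up to \<open>n\<close>, a nonzero factor of an
  integral domain.\<close>

lemma theorem9_summand:
  fixes n
  defines "a \<equiv> fps_X :: rat fps fps fps" and "b \<equiv> fps_const fps_X"
    and "c \<equiv> fps_const (fps_const fps_X)"
  shows "t_var ^ (2 * n + 1)
            * ((1 + t_var * V n v_var w_var) / (1 + t_var\<^sup>2 * V n v_var w_var))
            * (1 + z_var) ^ n * (1 + v_var) ^ n * (1 + w_var) ^ (n choose 2)
            * (\<Prod>i<n. V i v_var w_var / (1 + t_var\<^sup>2 * V i v_var w_var)) =
         fps_X * (fps_const (free_cells_weight a b c n) * layer_series a b n) +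
         fps_X\<^sup>2 * (fps_const (free_cells_weight a b c n * V n a b) * layer_series a b n)"
    (is "?L = ?R")
proof -
  let ?V = "\<lambda>i. V i v_var w_var" let ?D = "\<lambda>i. 1 + t_var\<^sup>2 * V i v_var w_var"
  let ?P = "(1 + z_var) ^ n * (1 + v_var) ^ n * (1 + w_var) ^ (n choose 2)"
  have vars: "t_var = fps_X" "v_var = fps_const a" "w_var = fps_const b" "z_var = fps_const c"
    by (simp_all add: t_var_def v_var_def w_var_def z_var_def a_def b_def c_def)
  have V: "?V i = fps_const (V i a b)" for i by (simp add: vars V_fps_const)
  have P: "?P = fps_const (free_cells_weight a b c n)"
    by (simp add: vars free_cells_weight_def fps_const_power flip: fps_const_1_eq_1)
  have D_nz: "?D i \<noteq> 0" for i using denominator_nth_0[of i] by force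
  have cancel: "x / ?D i * ?D i = x" for x i
    by (rule series_divide_cancel[OF denominator_nth_0])
  \<comment> \<open>\<open>?D n\<close> is paired with the single fraction, the \<open>?D i\<close>
    with \<open>i < n\<close> with the product.\<close>
  have "?L * (\<Prod>i\<le>n. ?D i) = t_var ^ (2 * n + 1) * ?P *
      ((1 + t_var * ?V n) / ?D n * ?D n) * ((\<Prod>i<n. ?V i / ?D i) * (\<Prod>i<n. ?D i))"
    by (simp only: lessThan_Suc_atMost[symmetric] prod.lessThan_Suc mult_ac)
  also have "\<dots> = t_var ^ (2 * n + 1) * ?P * (1 + t_var * ?V n) * (\<Prod>i<n. ?V i)"
    unfolding prod.distrib[symmetric] cancel ..
  also have "\<dots> = (t_var + t_var\<^sup>2 * ?V n) * ?P * (t_var ^ (2 * n) * (\<Prod>i<n. ?V i))"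
    by (simp add: algebra_simps power2_eq_square)
  also have "\<dots> = (t_var + t_var\<^sup>2 * ?V n) * ?P * layer_series a b n * (\<Prod>i\<le>n. ?D i)"
    unfolding V vars(1) layer_series_closed_form[symmetric] by (simp only: mult_ac)
  also have "(t_var + t_var\<^sup>2 * ?V n) * ?P * layer_series a b n = ?R"
    unfolding P V vars(1) fps_const_mult[symmetric] by (simp only: distrib_left distrib_right mult_ac)
  finally show ?thesis using D_nz by simp
qed

text \<open>Coefficient \<open>k\<close> of the partial sums is constant once more than
  \<open>k\<close> terms are included.\<close>

lemma sums_fpsI:
  fixes f :: "nat \<Rightarrow> 'a::comm_ring_1 fps"
  assumes "\<And>k n. k < n \<Longrightarrow> fps_nth (f n) k = 0"
    and "\<And>k. (\<Sum>n\<le>k. fps_nth (f n) k) = fps_nth S k"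
  shows "f sums S"
  unfolding sums_def
proof (rule tendsto_fpsI)
  fix k
  have "fps_nth (\<Sum>n<N. f n) k = fps_nth S k" if "k < N" for N
  proof -
    have "(\<Sum>n<N. fps_nth (f n) k) = (\<Sum>n\<le>k. fps_nth (f n) k)"
      using that by (intro sum.mono_neutral_right) (auto intro: assms(1))
    thus ?thesis by (simp add: fps_sum_nth assms(2))
  qed
  thus "\<forall>\<^sub>F N in sequentially. fps_nth (\<Sum>n<N. f n) k = fps_nth S k"
    using eventually_gt_at_top[of k] by (rule eventually_mono[rotated])
qed

theorem theorem9:
  shows "(\<lambda>n. t_var ^ (2 * n + 1)
            * ((1 + t_var * V n v_var w_var) / (1 + t_var\<^sup>2 * V n v_var w_var))
            * (1 + z_var) ^ n * (1 + v_var) ^ n * (1 + w_var) ^ (n choose 2)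
            * (\<Prod>i<n. V i v_var w_var / (1 + t_var\<^sup>2 * V i v_var w_var)))
         sums S_plus_gf"
proof -
  let ?a = "fps_X :: rat fps fps fps" and ?b = "fps_const fps_X :: rat fps fps fps"
    and ?c = "fps_const (fps_const fps_X) :: rat fps fps fps"
  let ?P = "free_cells_weight ?a ?b ?c" and ?Q = "signed_subset_sum ?a ?b"
  let ?f = "\<lambda>n. fps_X * (fps_const (?P n) * layer_series ?a ?b n) +
    fps_X\<^sup>2 * (fps_const (?P n * V n ?a ?b) * layer_series ?a ?b n)"
  have nth_0: "fps_nth (?f n) 0 = 0" for n by simp
  \<comment> \<open>\<open>layer_series\<close> has even degrees only, so the \<open>fps_X\<close>
    part lives in odd degrees and the \<open>fps_X\<^sup>2\<close> part in even ones.\<close>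
  have nth_odd: "fps_nth (?f n) (2 * s + 1) = ?P n * ?Q s n" for n s
    by (simp add: fps_X_power_mult_nth layer_series_def)
  have nth_even: "fps_nth (?f n) (2 * s + 2) = ?P n * V n ?a ?b * ?Q s n" for n s
    by (simp add: fps_X_power_mult_nth layer_series_def)
  have cases_k: "k = 0 \<or> (\<exists>s. k = 2 * s + 1) \<or> (\<exists>s. k = 2 * s + 2)" for k :: nat
    by presburger
  have "?f sums S_plus_gf"
  proof (rule sums_fpsI)
    fix k n :: nat assume "k < n"
    \<comment> \<open>In both parities \<open>s < k < n\<close>, where the signed sum
      vanishes.\<close>
    thus "fps_nth (?f n) k = 0"
      using cases_k[of k] nth_0 nth_odd nth_even by (auto simp: signed_subset_sum_eq_0)
  next
    fix k :: nat
    \<comment> \<open>Bridges the range \<open>n \<le> k\<close> of the coefficient sum and the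
      range \<open>n \<le> s\<close> of the row family sums.\<close>
    have trunc: "(\<Sum>n\<le>N. g n * ?Q s n) = (\<Sum>n\<le>s. g n * ?Q s n)" if "s \<le> N" for g s N
      using that by (intro sum.mono_neutral_right) (auto simp: signed_subset_sum_eq_0)
    consider "k = 0" | s where "k = 2 * s + 1" | s where "k = 2 * s + 2"
      using cases_k[of k] by auto
    thus "(\<Sum>n\<le>k. fps_nth (?f n) k) = fps_nth S_plus_gf k"
    proof cases
      case 1
      have no_mag_0: "{M. M \<in> S_plus \<and> mag M = 0} = {}" by (auto simp: S_plus_def)
      show ?thesis unfolding 1 S_plus_gf_nth no_mag_0 by simp
    next
      case 2
      hence "1 \<le> k" by simp
      show ?thesis
        unfolding S_plus_gf_nth sum_S_plus_mag[OF \<open>1 \<le> k\<close>]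
        unfolding 2 nth_odd sum_row_families_odd by (rule trunc) simp
    next
      case 3
      hence "1 \<le> k" by simp
      show ?thesis
        unfolding S_plus_gf_nth sum_S_plus_mag[OF \<open>1 \<le> k\<close>]
        unfolding 3 nth_even sum_row_families_even by (rule trunc) simp
    qed
  qed
  thus ?thesis unfolding theorem9_summand .
qed

end
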